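(* Let $1<p<2$ and let $\{\varepsilon_k:k\in\mathbb Z\}$ be independent and identically distributed real random variables such that $x^p\Pr\{|\varepsilon_0|>x\}\to0$ as $x\to\infty$ and $\operatorname E\varepsilon_0=0$. Let $\{\psi_j:j\in\mathbb Z\}\subset\mathbb R$ with $\psi_j=0$ for $j<0$ and $\sum_{j=0}^\infty|\psi_j|^p<\infty$. If $\mathcal W_n(p)\to\infty$ as $n\to\infty$, then $$\frac{S_n}{\mathcal W_n(p)}\to0\quad\text{in probability as } n\to\infty.$$
   Context: The linear process $\{X_k:k\in\mathbb Z\}$ is defined by the almost surely convergent series $X_k=\sum_{j=0}^\infty\psi_j\varepsilon_{k-j}$, and $S_n=\sum_{k=1}^nX_k$ for $n\ge1$. For $n\ge1$ and $j\in\mathbb Z$, $w_{nj}=\sum_{k=1}^n\psi_{k-j}$ (with the convention $\psi_i=0$ for $i<0$), and for $p\ge1$, $$\mathcal W_n(p)=\Bigl(\sum_{j=-\infty}^n|w_{nj}|^p\Bigr)^{1/p},$$ which is finite when $\sum_{j}|\psi_j|^p<\infty$. *)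

theory Defs
  imports "HOL-Probability.Probability"
begin

text \<open>
  The noise is a family \<open>\<epsilon> :: int \<Rightarrow> 'a \<Rightarrow> real\<close> of random variables and the coefficients are
  \<open>\<psi> :: int \<Rightarrow> real\<close>. The value of \<open>linear_process\<close> at \<open>\<omega>\<close> is the sum of the series where
  it converges; elsewhere \<open>suminf\<close> is an unspecified constant, which is harmless when the
  series converges almost surely.
\<close>

definition linear_process :: "(int \<Rightarrow> real) \<Rightarrow> (int \<Rightarrow> 'a \<Rightarrow> real) \<Rightarrow> int \<Rightarrow> 'a \<Rightarrow> real" where
  "linear_process \<psi> \<epsilon> k \<omega> = (\<Sum>j. \<psi> (int j) * \<epsilon> (k - int j) \<omega>)"

definition partial_sum :: "(int \<Rightarrow> real) \<Rightarrow> (int \<Rightarrow> 'a \<Rightarrow> real) \<Rightarrow> nat \<Rightarrow> 'a \<Rightarrow> real" where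
  "partial_sum \<psi> \<epsilon> n \<omega> = (\<Sum>k = 1..n. linear_process \<psi> \<epsilon> (int k) \<omega>)"

definition weight :: "(int \<Rightarrow> real) \<Rightarrow> nat \<Rightarrow> int \<Rightarrow> real" where
  "weight \<psi> n j = (\<Sum>k = 1..n. \<psi> (int k - j))"

text \<open>
  An \<open>infsum\<close> that is not summable is 0; here the sum converges whenever the series of the
  \<open>\<bar>\<psi> j\<bar> powr p\<close> does.
\<close>

definition weight_norm :: "(int \<Rightarrow> real) \<Rightarrow> real \<Rightarrow> nat \<Rightarrow> real" where
  "weight_norm \<psi> p n = (\<Sum>\<^sub>\<infinity>j\<in>{..int n}. \<bar>weight \<psi> n j\<bar> powr p) powr (1 / p)"

definition tendsto_in_probability ::
    "'a measure \<Rightarrow> (nat \<Rightarrow> 'a \<Rightarrow> real) \<Rightarrow> ('a \<Rightarrow> real) \<Rightarrow> bool" where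
  "tendsto_in_probability M Y Z \<longleftrightarrow>
     (\<forall>\<delta>>0. (\<lambda>n. \<P>(\<omega> in M. \<bar>Y n \<omega> - Z \<omega>\<bar> > \<delta>)) \<longlonglongrightarrow> 0)"

end

theory Submission
  imports Defs
begin

text \<open>
  Rearranging the double series gives \<open>S\<^sub>n = (\<Sum>j\<le>n. w\<^sub>n\<^sub>j \<epsilon>\<^sub>j)\<close>, so \<open>S\<^sub>n / W\<^sub>n\<close> is a weighted
  sum of independent copies of \<open>\<epsilon>\<^sub>0\<close> whose coefficients \<open>c\<^sub>j = w\<^sub>n\<^sub>j / W\<^sub>n\<close> have \<open>p\<close>-norm 1. The
  limit is 0 for two reasons.

  First, the coefficients are uniformly small. Two neighbouring weights differ by two values
  of \<open>\<psi>\<close>, which is bounded; hence a weight of size \<open>a\<close> is surrounded by about \<open>a\<close> weights of size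
  at least \<open>a / 2\<close>, and \<open>a powr (p + 1)\<close> is at most a constant times \<open>W\<^sub>n powr p\<close>. Since
  \<open>W\<^sub>n \<rightarrow> \<infinity>\<close>, each single weight is negligible against \<open>W\<^sub>n\<close> (\<open>weight_negligible\<close>).

  Secondly, the hypothesis on the tail says that at large scales \<open>x\<close> the tail probability,
  the tail first moment and the truncated second moment of \<open>\<epsilon>\<^sub>0\<close> are at most \<open>e\<close> times the
  corresponding power of \<open>x\<close>, with \<open>e\<close> as small as desired (\<open>weak_moment_bounds_small\<close>). The
  summand \<open>c\<^sub>j \<epsilon>\<^sub>j\<close> is truncated at 1, that is \<open>\<epsilon>\<^sub>j\<close> at the scale \<open>x = 1 / \<bar>c\<^sub>j\<bar>\<close>, which is large
  because \<open>c\<^sub>j\<close> is small. Each of the three quantities then costs at most \<open>e \<bar>c\<^sub>j\<bar> powr p\<close>, and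
  the second-moment method bounds the probability that the weighted sum exceeds \<open>\<delta>\<close> by a function
  of \<open>e\<close> and \<open>\<delta>\<close> that vanishes with \<open>e\<close> (\<open>weighted_sum_weak_bound\<close>).

  The same inequality with a bound that is valid at all scales (\<open>weak_moment_bounds_uniform\<close>)
  controls the blocks of the series \<open>X\<^sub>k\<close> in probability; Ottaviani's maximal inequality turns
  this into almost sure convergence (\<open>linear_process_AE_summable\<close>). So \<open>S\<^sub>n\<close> is the
  almost sure limit of the finite sums obtained by cutting \<open>\<psi>\<close> off at \<open>N\<close>, and it suffices to
  bound those, uniformly in large \<open>N\<close>. Cutting off changes only \<open>n + 1\<close> of the weights in
  question, by amounts that tend to 0 (\<open>normalized_truncated_weights\<close>), so the
  rearrangement is carried out on finite sums only.
\<close>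

section \<open>Tail probabilities and truncated moments\<close>

context real_distribution
begin

lemma integrable_truncated_square:
  "integrable M (\<lambda>y. y\<^sup>2 * indicator {y. \<bar>y\<bar> \<le> x} y)"
proof (rule integrable_const_bound[where B = "x\<^sup>2"])
  show "AE y in M. norm (y\<^sup>2 * indicator {y. \<bar>y\<bar> \<le> x} y) \<le> x\<^sup>2"
    by (intro AE_I2) (auto simp: indicator_def abs_le_square_iff[symmetric])
qed auto

lemma truncated_second_moment_halving:
  assumes "x > 0"
  shows "(\<integral>y. y\<^sup>2 * indicator {y. \<bar>y\<bar> \<le> x} y \<partial>M)
    \<le> (\<integral>y. y\<^sup>2 * indicator {y. \<bar>y\<bar> \<le> x / 2} y \<partial>M) + x\<^sup>2 * measure M {y. x / 2 < \<bar>y\<bar>}"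
proof -
  have "(\<integral>y. y\<^sup>2 * indicator {y. \<bar>y\<bar> \<le> x} y \<partial>M)
     \<le> (\<integral>y. y\<^sup>2 * indicator {y. \<bar>y\<bar> \<le> x / 2} y + x\<^sup>2 * indicator {y. x / 2 < \<bar>y\<bar>} y \<partial>M)"
    using assms
    by (intro integral_mono Bochner_Integration.integrable_add integrable_truncated_square
         integrable_mult_right integrable_real_indicator)
       (auto simp: indicator_def abs_le_square_iff[symmetric] emeasure_eq_measure)
  also have "\<dots> = (\<integral>y. y\<^sup>2 * indicator {y. \<bar>y\<bar> \<le> x / 2} y \<partial>M)
      + (\<integral>y. x\<^sup>2 * indicator {y. x / 2 < \<bar>y\<bar>} y \<partial>M)"
    by (intro Bochner_Integration.integral_add integrable_truncated_square integrable_mult_right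
         integrable_real_indicator)
      (auto simp: emeasure_eq_measure)
  also have "(\<integral>y. x\<^sup>2 * indicator {y. x / 2 < \<bar>y\<bar>} y \<partial>M) = x\<^sup>2 * measure M {y. x / 2 < \<bar>y\<bar>}"
    by simp
  finally show ?thesis .
qed

text \<open>
  Halving the truncation level costs \<open>x\<^sup>2\<close> times a tail probability, which is of order
  \<open>x powr (2 - p)\<close>. As \<open>p < 2\<close>, these costs form a geometric series along \<open>x, x / 2, x / 4, \<dots>\<close>,
  dominated by its first term; the halving stops at level \<open>2 * r\<close>, where the second moment is
  trivially at most \<open>4 * r\<^sup>2\<close>.
\<close>

lemma truncated_second_moment_le:
  assumes p: "p < 2" and r: "0 < r"
    and tail: "\<And>x. x \<ge> r \<Longrightarrow> measure M {y. x < \<bar>y\<bar>} \<le> e * x powr -p"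
    and "0 < x"
  shows "(\<integral>y. y\<^sup>2 * indicator {y. \<bar>y\<bar> \<le> x} y \<partial>M)
    \<le> 4 * r\<^sup>2 + 2 powr p / (1 - 2 powr (p - 2)) * e * x powr (2 - p)"
proof -
  define C where "C = 2 powr p / (1 - 2 powr (p - 2))"
  have lt1: "(2::real) powr (p - 2) < 1"
    using p by (simp add: powr_less_one)
  have "C * (1 - 2 powr (p - 2)) = 2 powr p"
    using lt1 unfolding C_def by (intro nonzero_eq_divide_eq[THEN iffD1]) auto
  (* C is the sum of the geometric series, that is, the fixed point of the recursion. *)
  then have "2 powr p + C * 2 powr (p - 2) = C"
    by (simp add: algebra_simps)
  moreover have "C \<ge> 0"
    using lt1 by (simp add: C_def)
  ultimately have C: "C \<ge> 0" "2 powr p + C * 2 powr (p - 2) = C"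
    by auto
  have e: "e \<ge> 0"
    using order_trans[OF measure_nonneg tail[of r]] r by (simp add: zero_le_mult_iff)
  have "(\<integral>y. y\<^sup>2 * indicator {y. \<bar>y\<bar> \<le> x} y \<partial>M) \<le> 4 * r\<^sup>2 + C * e * x powr (2 - p)"
    if "x > 0" "x \<le> 2 ^ Suc n * r" for n x
    using that
  proof (induction n arbitrary: x)
    case 0
    have "(\<integral>y. y\<^sup>2 * indicator {y. \<bar>y\<bar> \<le> x} y \<partial>M) \<le> (\<integral>y. x\<^sup>2 \<partial>M)"
      by (intro integral_mono integrable_truncated_square)
        (auto simp: indicator_def abs_le_square_iff[symmetric])
    also have "\<dots> = x\<^sup>2" using prob_space by simp
    also have "\<dots> \<le> (2 * r)\<^sup>2" using 0 by (intro power_mono) auto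
    finally have "(\<integral>y. y\<^sup>2 * indicator {y. \<bar>y\<bar> \<le> x} y \<partial>M) \<le> 4 * r\<^sup>2"
      by (simp add: power_mult_distrib)
    moreover have "0 \<le> C * e * x powr (2 - p)" using C e by simp
    ultimately show ?case by linarith
  next
    case (Suc n)
    show ?case
    proof (cases "x \<le> 2 ^ Suc n * r")
      case True
      then show ?thesis using Suc by blast
    next
      case False
      have "(1::real) \<le> 2 ^ n" by simp
      then have "2 * r \<le> 2 ^ Suc n * r" using r by simp
      with False have xr: "r \<le> x / 2" by linarith
      have "(\<integral>y. y\<^sup>2 * indicator {y. \<bar>y\<bar> \<le> x} y \<partial>M)
         \<le> (\<integral>y. y\<^sup>2 * indicator {y. \<bar>y\<bar> \<le> x / 2} y \<partial>M) + x\<^sup>2 * measure M {y. x / 2 < \<bar>y\<bar>}"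
        using Suc.prems by (intro truncated_second_moment_halving)
      also have "\<dots> \<le> (4 * r\<^sup>2 + C * e * (x / 2) powr (2 - p)) + x\<^sup>2 * (e * (x / 2) powr - p)"
        using Suc.prems by (intro add_mono Suc.IH mult_left_mono tail xr) auto
      also have "\<dots> = 4 * r\<^sup>2 + (2 powr p + C * 2 powr (p - 2)) * e * x powr (2 - p)"
      proof -
        have "x\<^sup>2 = x powr 2" using Suc.prems by (simp add: powr_numeral)
        then have "x\<^sup>2 * (x / 2) powr - p = 2 powr p * x powr (2 - p)"
          using Suc.prems by (simp add: powr_divide powr_minus powr_diff field_simps)
        moreover have "(x / 2) powr (2 - p) = 2 powr (p - 2) * x powr (2 - p)"
          using Suc.prems by (simp add: powr_divide powr_minus powr_diff field_simps)
        ultimately show ?thesis by (simp add: algebra_simps)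
      qed
      finally show ?thesis unfolding C .
    qed
  qed
  moreover obtain n where "x / r < 2 ^ n"
    using real_arch_pow[of 2 "x / r"] by auto
  then have "x \<le> 2 ^ Suc n * r" using r \<open>x > 0\<close> by (simp add: field_simps)
  ultimately show ?thesis using \<open>0 < x\<close> unfolding C_def by blast
qed

text \<open>
  The dual recursion: doubling the level costs \<open>2 * x\<close> times a tail probability, of order
  \<open>x powr (1 - p)\<close>, a geometric series along \<open>x, 2 * x, 4 * x, \<dots>\<close> because \<open>p > 1\<close>. Integrability makes
  the remainder at level \<open>2 ^ n * x\<close> vanish.
\<close>

lemma tail_first_moment_le:
  assumes p: "1 < p" and r: "0 < r"
    and tail: "\<And>x. x \<ge> r \<Longrightarrow> measure M {y. x < \<bar>y\<bar>} \<le> e * x powr -p"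
    and int: "integrable M (\<lambda>y. y)"
    and x: "r \<le> x"
  shows "(\<integral>y. \<bar>y\<bar> * indicator {y. x < \<bar>y\<bar>} y \<partial>M) \<le> 2 / (1 - 2 powr (1 - p)) * e * x powr (1 - p)"
proof -
  define f where "f x = (\<integral>y. \<bar>y\<bar> * indicator {y. x < \<bar>y\<bar>} y \<partial>M)" for x
  define C where "C = 2 / (1 - 2 powr (1 - p))"
  have lt1: "(2::real) powr (1 - p) < 1"
    using p by (simp add: powr_less_one)
  have "C * (1 - 2 powr (1 - p)) = 2"
    using lt1 unfolding C_def by (intro nonzero_eq_divide_eq[THEN iffD1]) auto
  (* C is the sum of the geometric series, that is, the fixed point of the recursion. *)
  then have "2 + C * 2 powr (1 - p) = C"
    by (simp add: algebra_simps)
  moreover have "C \<ge> 0"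
    using lt1 by (simp add: C_def)
  ultimately have C: "C \<ge> 0" "2 + C * 2 powr (1 - p) = C"
    by auto
  have e: "e \<ge> 0"
    using order_trans[OF measure_nonneg tail[of r]] r by (simp add: zero_le_mult_iff)
  have intf: "integrable M (\<lambda>y. \<bar>y\<bar> * indicator {y. x < \<bar>y\<bar>} y)" for x
    by (rule Bochner_Integration.integrable_bound[OF int]) (auto simp: indicator_def)
  have doubling: "f x \<le> f (2 * x) + 2 * x * measure M {y. x < \<bar>y\<bar>}" if "x > 0" for x
  proof -
    have "f x \<le> (\<integral>y. \<bar>y\<bar> * indicator {y. 2 * x < \<bar>y\<bar>} y + 2 * x * indicator {y. x < \<bar>y\<bar>} y \<partial>M)"
      unfolding f_def using that
      by (intro integral_mono Bochner_Integration.integrable_add intf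
         integrable_mult_right integrable_real_indicator)
       (auto simp: indicator_def emeasure_eq_measure)
    also have "\<dots> = f (2 * x) + (\<integral>y. 2 * x * indicator {y. x < \<bar>y\<bar>} y \<partial>M)"
      unfolding f_def
      by (intro Bochner_Integration.integral_add intf integrable_mult_right
         integrable_real_indicator)
        (auto simp: emeasure_eq_measure)
    also have "(\<integral>y. 2 * x * indicator {y. x < \<bar>y\<bar>} y \<partial>M) = 2 * x * measure M {y. x < \<bar>y\<bar>}"
      by simp
    finally show ?thesis .
  qed
  have step: "f x \<le> f (2 ^ n * x) + C * e * x powr (1 - p)" if "r \<le> x" for n x
    using that
  proof (induction n arbitrary: x)
    case 0
    then show ?case using C e by simp
  next
    case (Suc n)
    have "x > 0" using Suc.prems r by linarith
    have "f x \<le> f (2 * x) + 2 * x * measure M {y. x < \<bar>y\<bar>}"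
      using \<open>x > 0\<close> by (rule doubling)
    also have "\<dots> \<le> (f (2 ^ n * (2 * x)) + C * e * (2 * x) powr (1 - p)) + 2 * x * (e * x powr - p)"
      using Suc.prems \<open>x > 0\<close> r by (intro add_mono Suc.IH mult_left_mono tail) auto
    also have "\<dots> = f (2 ^ Suc n * x) + (2 + C * 2 powr (1 - p)) * e * x powr (1 - p)"
    proof -
      have "x * x powr - p = x powr (1 - p)"
        using \<open>x > 0\<close> by (simp add: powr_diff powr_minus field_simps)
      moreover have "(2 * x) powr (1 - p) = 2 powr (1 - p) * x powr (1 - p)"
        using \<open>x > 0\<close> by (simp add: powr_mult)
      ultimately show ?thesis by (simp add: algebra_simps)
    qed
    finally show ?case unfolding C .
  qed
  have "(\<lambda>n. f (2 ^ n * x)) \<longlonglongrightarrow> (\<integral>y. 0 \<partial>M)"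
    unfolding f_def
  proof (rule integral_dominated_convergence[where w = "\<lambda>y. \<bar>y\<bar>"])
    show "integrable M (\<lambda>y. \<bar>y\<bar>)" using int by (rule integrable_abs)
    show "AE y in M. (\<lambda>n. \<bar>y\<bar> * indicator {y. 2 ^ n * x < \<bar>y\<bar>} y) \<longlonglongrightarrow> 0"
    proof (intro AE_I2)
      fix y
      have "x > 0" using x r by linarith
      obtain N where N: "\<bar>y\<bar> / x < 2 ^ N"
        using real_arch_pow[of 2 "\<bar>y\<bar> / x"] by auto
      have "\<bar>y\<bar> * indicator {y. 2 ^ n * x < \<bar>y\<bar>} y = 0" if "n \<ge> N" for n
      proof -
        have "(2::real) ^ N \<le> 2 ^ n" using that by (intro power_increasing) auto
        with N have "\<bar>y\<bar> / x < 2 ^ n" by linarith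
        then show ?thesis using \<open>x > 0\<close> by (simp add: field_simps)
      qed
      then show "(\<lambda>n. \<bar>y\<bar> * indicator {y. 2 ^ n * x < \<bar>y\<bar>} y) \<longlonglongrightarrow> 0"
        by (intro tendsto_eventually) (auto simp: eventually_sequentially)
    qed
  qed (auto simp: indicator_def)
  then have "(\<lambda>n. f (2 ^ n * x) + C * e * x powr (1 - p)) \<longlonglongrightarrow> 0 + C * e * x powr (1 - p)"
    by (intro tendsto_intros) simp
  then have "f x \<le> 0 + C * e * x powr (1 - p)"
    by (rule LIMSEQ_le_const) (use step[OF x] in auto)
  then show ?thesis unfolding f_def C_def by simp
qed

end

text \<open>
  These are the bounds that a random variable in weak \<open>L\<^sup>p\<close> satisfies for \<open>1 < p < 2\<close>. The
  level \<open>r\<close> below which nothing is claimed lets one predicate serve both for a fixed constant at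
  all scales (\<open>r = 0\<close>) and for a small constant at large scales.
\<close>

definition weak_moment_bounds :: "real measure \<Rightarrow> real \<Rightarrow> real \<Rightarrow> real \<Rightarrow> bool" where
  "weak_moment_bounds D p r e \<longleftrightarrow> (\<forall>x>0. r \<le> x \<longrightarrow>
     measure D {y. x < \<bar>y\<bar>} \<le> e * x powr -p \<and>
     (\<integral>y. \<bar>y\<bar> * indicator {y. x < \<bar>y\<bar>} y \<partial>D) \<le> e * x powr (1 - p) \<and>
     (\<integral>y. y\<^sup>2 * indicator {y. \<bar>y\<bar> \<le> x} y \<partial>D) \<le> e * x powr (2 - p))"

lemma weak_moment_bounds_nonneg:
  assumes "weak_moment_bounds D p r e"
  shows "0 \<le> e"
proof -
  define x where "x = max 1 r"
  have x: "0 < x" "r \<le> x" by (auto simp: x_def)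
  have "0 \<le> measure D {y. x < \<bar>y\<bar>}" by simp
  also have "\<dots> \<le> e * x powr -p"
    using assms x unfolding weak_moment_bounds_def by blast
  finally show ?thesis
    using x by (simp add: zero_le_mult_iff)
qed

text \<open>
  The tail hypothesis gives constant \<open>d\<close> from some level \<open>r1\<close> on, and the two moment lemmas
  multiply it by factors depending on \<open>p\<close> only. The term \<open>4 * r1\<^sup>2\<close> left by the truncated second
  moment is absorbed by raising the level, since \<open>x powr (2 - p)\<close> is unbounded.
\<close>

lemma (in real_distribution) weak_moment_bounds_small:
  assumes p: "1 < p" "p < 2"
    and tail: "((\<lambda>x. x powr p * measure M {y. x < \<bar>y\<bar>}) \<longlongrightarrow> 0) at_top"
    and int: "integrable M (\<lambda>y. y)"
    and e: "0 < e"
  obtains r where "0 < r" "weak_moment_bounds M p r e"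
proof -
  define C1 where "C1 = 2 / (1 - 2 powr (1 - p))"
  define C2 where "C2 = 2 powr p / (1 - 2 powr (p - 2))"
  have "(2::real) powr (p - 2) < 1" "(2::real) powr (1 - p) < 1"
    using p by (auto simp: powr_less_one)
  then have C: "C1 \<ge> 0" "C2 \<ge> 0" by (auto simp: C1_def C2_def)
  define d where "d = e / (2 * (1 + C1 + C2))"
  have d: "d > 0" "d \<le> e" "C1 * d \<le> e" "C2 * d \<le> e / 2"
    using e C by (auto simp: d_def field_simps mult_nonneg_nonneg)
  have "eventually (\<lambda>x. x powr p * measure M {y. x < \<bar>y\<bar>} < d) at_top"
    using tail d(1) by (rule order_tendstoD)
  then obtain r0 where r0: "\<And>x. x \<ge> r0 \<Longrightarrow> x powr p * measure M {y. x < \<bar>y\<bar>} < d"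
    by (auto simp: eventually_at_top_linorder)
  define r1 where "r1 = max r0 1"
  have r1: "r1 > 0" by (simp add: r1_def)
  have t: "measure M {y. x < \<bar>y\<bar>} \<le> d * x powr -p" if "x \<ge> r1" for x
  proof -
    have "x > 0" using that r1 by linarith
    have "x powr p * measure M {y. x < \<bar>y\<bar>} < d" using that by (intro r0) (simp add: r1_def)
    then show ?thesis using \<open>x > 0\<close> by (simp add: powr_minus field_simps)
  qed
  define r2 where "r2 = (8 * r1\<^sup>2 / e) powr (1 / (2 - p))"
  have r2: "8 * r1\<^sup>2 / e \<le> x powr (2 - p)" if "x \<ge> r2" for x
  proof -
    have "8 * r1\<^sup>2 / e = r2 powr (2 - p)"
      using p r1 e by (simp add: r2_def powr_powr)
    also have "\<dots> \<le> x powr (2 - p)"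
      using that p by (intro powr_mono2) (auto simp: r2_def)
    finally show ?thesis .
  qed
  define r where "r = max r1 r2"
  have "weak_moment_bounds M p r e"
    unfolding weak_moment_bounds_def
  proof (intro allI impI conjI)
    fix x assume x: "0 < x" "r \<le> x"
    then have xr: "r1 \<le> x" "r2 \<le> x" by (auto simp: r_def)
    show "measure M {y. x < \<bar>y\<bar>} \<le> e * x powr -p"
      using t[OF xr(1)] d(2) by (rule order_trans[OF _ mult_right_mono]) auto
    have "(\<integral>y. \<bar>y\<bar> * indicator {y. x < \<bar>y\<bar>} y \<partial>M) \<le> C1 * d * x powr (1 - p)"
      unfolding C1_def using p r1 t int xr(1) by (intro tail_first_moment_le) auto
    also have "\<dots> \<le> e * x powr (1 - p)" using d by (intro mult_right_mono) auto
    finally show "(\<integral>y. \<bar>y\<bar> * indicator {y. x < \<bar>y\<bar>} y \<partial>M) \<le> e * x powr (1 - p)" .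
    have "(\<integral>y. y\<^sup>2 * indicator {y. \<bar>y\<bar> \<le> x} y \<partial>M) \<le> 4 * r1\<^sup>2 + C2 * d * x powr (2 - p)"
      unfolding C2_def using p r1 t x by (intro truncated_second_moment_le) auto
    also have "\<dots> \<le> e / 2 * x powr (2 - p) + e / 2 * x powr (2 - p)"
      using d r2[OF xr(2)] e by (intro add_mono mult_right_mono) (auto simp: field_simps)
    finally show "(\<integral>y. y\<^sup>2 * indicator {y. \<bar>y\<bar> \<le> x} y \<partial>M) \<le> e * x powr (2 - p)" by simp
  qed
  moreover have "r > 0" using r1 by (simp add: r_def)
  ultimately show ?thesis using that by blast
qed

text \<open>
  Below the level where the tail hypothesis takes effect, the tail probability is at most 1
  and \<open>x powr p\<close> is bounded, so one constant covers all \<open>x > 0\<close>.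
\<close>

lemma (in real_distribution) weak_moment_bounds_uniform:
  assumes p: "1 < p" "p < 2"
    and tail: "((\<lambda>x. x powr p * measure M {y. x < \<bar>y\<bar>}) \<longlongrightarrow> 0) at_top"
    and int: "integrable M (\<lambda>y. y)"
  obtains K where "weak_moment_bounds M p 0 K"
proof -
  define C1 where "C1 = 2 / (1 - 2 powr (1 - p))"
  define C2 where "C2 = 2 powr p / (1 - 2 powr (p - 2))"
  have "(2::real) powr (p - 2) < 1" "(2::real) powr (1 - p) < 1"
    using p by (auto simp: powr_less_one)
  then have C: "C1 \<ge> 0" "C2 \<ge> 0" by (auto simp: C1_def C2_def)
  have "eventually (\<lambda>x. x powr p * measure M {y. x < \<bar>y\<bar>} < 1) at_top"
    using tail by (rule order_tendstoD) simp
  then obtain r0 where r0: "\<And>x. x \<ge> r0 \<Longrightarrow> x powr p * measure M {y. x < \<bar>y\<bar>} < 1"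
    by (auto simp: eventually_at_top_linorder)
  define d where "d = max 1 (\<bar>r0\<bar> powr p)"
  have d: "d > 0" by (simp add: d_def)
  have t: "measure M {y. x < \<bar>y\<bar>} \<le> d * x powr -p" if "x > 0" for x
  proof -
    have "x powr p * measure M {y. x < \<bar>y\<bar>} \<le> d"
    proof (cases "x \<ge> r0")
      case True
      then show ?thesis using r0[of x] by (simp add: d_def)
    next
      case False
      have "x powr p * measure M {y. x < \<bar>y\<bar>} \<le> \<bar>r0\<bar> powr p * 1"
        using False that p by (intro mult_mono powr_mono2) auto
      then show ?thesis by (simp add: d_def)
    qed
    then show ?thesis using \<open>x > 0\<close> by (simp add: powr_minus field_simps)
  qed
  define K where "K = (1 + C1 + C2) * d"
  have K: "d \<le> K" "C1 * d \<le> K" "C2 * d \<le> K"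
    using C d by (auto simp: K_def algebra_simps)
  have "weak_moment_bounds M p 0 K"
    unfolding weak_moment_bounds_def
  proof (intro allI impI conjI)
    fix x :: real assume x: "0 < x"
    show "measure M {y. x < \<bar>y\<bar>} \<le> K * x powr -p"
      using t[OF x] K(1) by (rule order_trans[OF _ mult_right_mono]) auto
    have "(\<integral>y. \<bar>y\<bar> * indicator {y. x < \<bar>y\<bar>} y \<partial>M) \<le> C1 * d * x powr (1 - p)"
      unfolding C1_def using p t int x by (intro tail_first_moment_le[where r = x]) auto
    also have "\<dots> \<le> K * x powr (1 - p)" using K by (intro mult_right_mono) auto
    finally show "(\<integral>y. \<bar>y\<bar> * indicator {y. x < \<bar>y\<bar>} y \<partial>M) \<le> K * x powr (1 - p)" .
    have "(\<integral>y. y\<^sup>2 * indicator {y. \<bar>y\<bar> \<le> x} y \<partial>M) \<le> C2 * d * x powr (2 - p)"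
    (* The tail bound holds at every level, so the term 4 * r^2 can be made arbitrarily small. *)
    proof (rule field_le_epsilon)
      fix \<eta> :: real assume "\<eta> > 0"
      have "(\<integral>y. y\<^sup>2 * indicator {y. \<bar>y\<bar> \<le> x} y \<partial>M)
          \<le> 4 * (sqrt (\<eta> / 4))\<^sup>2 + C2 * d * x powr (2 - p)"
        unfolding C2_def
      proof (rule truncated_second_moment_le)
        show s: "0 < sqrt (\<eta> / 4)" using \<open>\<eta> > 0\<close> by simp
        show "measure M {y. z < \<bar>y\<bar>} \<le> d * z powr -p" if "sqrt (\<eta> / 4) \<le> z" for z
          using that s by (intro t) linarith
      qed (use p x in auto)
      then show "(\<integral>y. y\<^sup>2 * indicator {y. \<bar>y\<bar> \<le> x} y \<partial>M) \<le> C2 * d * x powr (2 - p) + \<eta>"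
        using \<open>\<eta> > 0\<close> by simp
    qed
    also have "\<dots> \<le> K * x powr (2 - p)" using K by (intro mult_right_mono) auto
    finally show "(\<integral>y. y\<^sup>2 * indicator {y. \<bar>y\<bar> \<le> x} y \<partial>M) \<le> K * x powr (2 - p)" .
  qed
  then show ?thesis using that by blast
qed

section \<open>A weak-type inequality for weighted sums\<close>

context prob_space
begin

text \<open>
  By independence the mixed moments factor, so off the diagonal only products of means remain.
  The means are kept, as truncation destroys centring.
\<close>

lemma indep_second_moment_sum_le:
  fixes Y :: "'i \<Rightarrow> 'a \<Rightarrow> real"
  assumes fin: "finite I" and ind: "indep_vars (\<lambda>_. borel) Y I"
    and sq: "\<And>i. i \<in> I \<Longrightarrow> integrable M (\<lambda>\<omega>. (Y i \<omega>)\<^sup>2)"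
  shows "integrable M (\<lambda>\<omega>. (\<Sum>i\<in>I. Y i \<omega>)\<^sup>2)"
    and "expectation (\<lambda>\<omega>. (\<Sum>i\<in>I. Y i \<omega>)\<^sup>2)
      \<le> (\<Sum>i\<in>I. expectation (\<lambda>\<omega>. (Y i \<omega>)\<^sup>2)) + (\<Sum>i\<in>I. \<bar>expectation (Y i)\<bar>)\<^sup>2"
proof -
  have meas: "random_variable borel (Y i)" if "i \<in> I" for i
    using ind that by (auto simp: indep_vars_def)
  have int: "integrable M (Y i)" if "i \<in> I" for i
    using square_integrable_imp_integrable[OF meas[OF that] sq[OF that]] .
  have expand: "(\<Sum>i\<in>I. Y i \<omega>)\<^sup>2 = (\<Sum>i\<in>I. \<Sum>j\<in>I. Y i \<omega> * Y j \<omega>)" for \<omega>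
    by (simp add: power2_eq_square sum_product)
  have pair: "integrable M (\<lambda>\<omega>. Y i \<omega> * Y j \<omega>) \<and>
      expectation (\<lambda>\<omega>. Y i \<omega> * Y j \<omega>)
        \<le> (if i = j then expectation (\<lambda>\<omega>. (Y i \<omega>)\<^sup>2) else 0) + \<bar>expectation (Y i)\<bar> * \<bar>expectation (Y j)\<bar>"
    if ij: "i \<in> I" "j \<in> I" for i j
  proof (cases "i = j")
    case True
    then show ?thesis using sq[OF ij(1)] by (simp add: power2_eq_square)
  next
    case False
    have iv: "indep_vars (\<lambda>_. borel) Y {i, j}"
      using ind ij by (rule_tac indep_vars_subset) auto
    have "integrable M (\<lambda>\<omega>. \<Prod>k\<in>{i, j}. Y k \<omega>)"
      using ij int by (intro indep_vars_integrable iv) auto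
    moreover have "expectation (\<lambda>\<omega>. \<Prod>k\<in>{i, j}. Y k \<omega>) = (\<Prod>k\<in>{i, j}. expectation (Y k))"
      using ij int by (intro indep_vars_lebesgue_integral iv) auto
    moreover have "expectation (Y i) * expectation (Y j) \<le> \<bar>expectation (Y i)\<bar> * \<bar>expectation (Y j)\<bar>"
      by (metis abs_ge_self abs_mult)
    ultimately show ?thesis using False by simp
  qed
  show "integrable M (\<lambda>\<omega>. (\<Sum>i\<in>I. Y i \<omega>)\<^sup>2)"
    unfolding expand using pair by (intro Bochner_Integration.integrable_sum) auto
  have "expectation (\<lambda>\<omega>. (\<Sum>i\<in>I. Y i \<omega>)\<^sup>2) = (\<Sum>i\<in>I. \<Sum>j\<in>I. expectation (\<lambda>\<omega>. Y i \<omega> * Y j \<omega>))"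
    unfolding expand using pair
    by (subst Bochner_Integration.integral_sum) (auto intro!: sum.cong Bochner_Integration.integral_sum)
  also have "\<dots> \<le> (\<Sum>i\<in>I. \<Sum>j\<in>I. (if i = j then expectation (\<lambda>\<omega>. (Y i \<omega>)\<^sup>2) else 0)
      + \<bar>expectation (Y i)\<bar> * \<bar>expectation (Y j)\<bar>)"
    using pair by (intro sum_mono) auto
  also have "\<dots> = (\<Sum>i\<in>I. expectation (\<lambda>\<omega>. (Y i \<omega>)\<^sup>2)) + (\<Sum>i\<in>I. \<bar>expectation (Y i)\<bar>)\<^sup>2"
    using fin by (simp add: sum.distrib power2_eq_square sum_product)
  finally show "expectation (\<lambda>\<omega>. (\<Sum>i\<in>I. Y i \<omega>)\<^sup>2)
      \<le> (\<Sum>i\<in>I. expectation (\<lambda>\<omega>. (Y i \<omega>)\<^sup>2)) + (\<Sum>i\<in>I. \<bar>expectation (Y i)\<bar>)\<^sup>2" .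
qed

text \<open>
  Truncating \<open>c * X\<close> at 1 means truncating \<open>X\<close> at \<open>1 / \<bar>c\<bar>\<close>, and at that scale each of the
  three bounds, multiplied by the matching power of \<open>\<bar>c\<bar>\<close>, becomes \<open>e * \<bar>c\<bar> powr p\<close>. Since \<open>X\<close> has
  mean 0, the truncated mean is minus the mean of the part cut away, whence the tail first moment.
\<close>

lemma truncated_multiple_bounds:
  fixes X :: "'a \<Rightarrow> real"
  assumes X[measurable]: "random_variable borel X" and D: "distr M borel X = D"
    and int: "integrable D (\<lambda>y. y)" and mean: "(\<integral>y. y \<partial>D) = 0"
    and bd: "weak_moment_bounds D p r e"
    and c: "\<bar>c\<bar> * r \<le> 1"
    and t_def: "t = (\<lambda>y. y * indicator {y. \<bar>y\<bar> \<le> 1} y)"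
  shows "prob {\<omega> \<in> space M. 1 < \<bar>c * X \<omega>\<bar>} \<le> e * \<bar>c\<bar> powr p"
    and "\<bar>expectation (\<lambda>\<omega>. t (c * X \<omega>))\<bar> \<le> e * \<bar>c\<bar> powr p"
    and "expectation (\<lambda>\<omega>. (t (c * X \<omega>))\<^sup>2) \<le> e * \<bar>c\<bar> powr p"
proof -
  have "prob {\<omega> \<in> space M. 1 < \<bar>c * X \<omega>\<bar>} \<le> e * \<bar>c\<bar> powr p \<and>
    \<bar>expectation (\<lambda>\<omega>. t (c * X \<omega>))\<bar> \<le> e * \<bar>c\<bar> powr p \<and>
    expectation (\<lambda>\<omega>. (t (c * X \<omega>))\<^sup>2) \<le> e * \<bar>c\<bar> powr p"
  proof (cases "c = 0")
    case True
    then show ?thesis by (simp add: t_def)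
  next
    case False
    define x where "x = 1 / \<bar>c\<bar>"
    have x: "x > 0" "r \<le> x" using False c by (auto simp: x_def field_simps)
    have cp: "x powr -p = \<bar>c\<bar> powr p" "\<bar>c\<bar> * x powr (1 - p) = \<bar>c\<bar> powr p"
        "c\<^sup>2 * x powr (2 - p) = \<bar>c\<bar> powr p"
    proof -
      have "c\<^sup>2 = \<bar>c\<bar> powr 2" using False by (simp add: powr_numeral)
      then show "x powr -p = \<bar>c\<bar> powr p" "\<bar>c\<bar> * x powr (1 - p) = \<bar>c\<bar> powr p"
        "c\<^sup>2 * x powr (2 - p) = \<bar>c\<bar> powr p"
        using False by (auto simp: x_def powr_divide powr_minus powr_diff field_simps)
    qed
    have less_iff: "1 < \<bar>c * y\<bar> \<longleftrightarrow> x < \<bar>y\<bar>" and le_iff: "\<bar>c * y\<bar> \<le> 1 \<longleftrightarrow> \<bar>y\<bar> \<le> x" for y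
      using False by (auto simp: x_def field_simps abs_mult)
    from bd x have B: "measure D {y. x < \<bar>y\<bar>} \<le> e * x powr -p"
      "(\<integral>y. \<bar>y\<bar> * indicator {y. x < \<bar>y\<bar>} y \<partial>D) \<le> e * x powr (1 - p)"
      "(\<integral>y. y\<^sup>2 * indicator {y. \<bar>y\<bar> \<le> x} y \<partial>D) \<le> e * x powr (2 - p)"
      by (auto simp: weak_moment_bounds_def)
    have setsD[measurable_cong]: "sets D = sets borel" by (simp add: D[symmetric])
    have "prob {\<omega> \<in> space M. 1 < \<bar>c * X \<omega>\<bar>} = measure D {y. x < \<bar>y\<bar>}"
      unfolding D[symmetric] by (subst measure_distr) (auto simp: less_iff vimage_def Int_def conj_commute)
    with B(1) cp have 1: "prob {\<omega> \<in> space M. 1 < \<bar>c * X \<omega>\<bar>} \<le> e * \<bar>c\<bar> powr p" by simp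
    have "expectation (\<lambda>\<omega>. (t (c * X \<omega>))\<^sup>2) = (\<integral>y. (t (c * y))\<^sup>2 \<partial>D)"
      unfolding D[symmetric] by (subst integral_distr) (auto simp: t_def)
    also have "\<dots> = (\<integral>y. c\<^sup>2 * (y\<^sup>2 * indicator {y. \<bar>y\<bar> \<le> x} y) \<partial>D)"
      by (intro Bochner_Integration.integral_cong)
        (auto simp: t_def indicator_def le_iff power_mult_distrib)
    also have "\<dots> \<le> c\<^sup>2 * (e * x powr (2 - p))"
      using B(3) by (simp add: mult_left_mono)
    also have "\<dots> = e * (c\<^sup>2 * x powr (2 - p))" by simp
    finally have 3: "expectation (\<lambda>\<omega>. (t (c * X \<omega>))\<^sup>2) \<le> e * \<bar>c\<bar> powr p" unfolding cp .
    have intt: "integrable D (\<lambda>y. y * indicator {y. x < \<bar>y\<bar>} y)"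
      by (rule Bochner_Integration.integrable_bound[OF int]) (auto simp: indicator_def)
    have "expectation (\<lambda>\<omega>. t (c * X \<omega>)) = (\<integral>y. t (c * y) \<partial>D)"
      unfolding D[symmetric] by (subst integral_distr) (auto simp: t_def)
    also have "\<dots> = (\<integral>y. c * (y - y * indicator {y. x < \<bar>y\<bar>} y) \<partial>D)"
      by (intro Bochner_Integration.integral_cong) (auto simp: t_def indicator_def le_iff)
    also have "\<dots> = - (c * (\<integral>y. y * indicator {y. x < \<bar>y\<bar>} y \<partial>D))"
      using int intt mean by simp
    finally have "\<bar>expectation (\<lambda>\<omega>. t (c * X \<omega>))\<bar> = \<bar>c\<bar> * \<bar>\<integral>y. y * indicator {y. x < \<bar>y\<bar>} y \<partial>D\<bar>"
      by (simp add: abs_mult)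
    also have "\<dots> \<le> \<bar>c\<bar> * (\<integral>y. \<bar>y * indicator {y. x < \<bar>y\<bar>} y\<bar> \<partial>D)"
      by (intro mult_left_mono integral_abs_bound) auto
    also have "\<dots> = \<bar>c\<bar> * (\<integral>y. \<bar>y\<bar> * indicator {y. x < \<bar>y\<bar>} y \<partial>D)"
      by (simp add: abs_mult)
    also have "\<dots> \<le> \<bar>c\<bar> * (e * x powr (1 - p))"
      using B(2) by (intro mult_left_mono) auto
    also have "\<dots> = e * (\<bar>c\<bar> * x powr (1 - p))" by simp
    finally have 2: "\<bar>expectation (\<lambda>\<omega>. t (c * X \<omega>))\<bar> \<le> e * \<bar>c\<bar> powr p" unfolding cp .
    show ?thesis using 1 2 3 by blast
  qed
  then show "prob {\<omega> \<in> space M. 1 < \<bar>c * X \<omega>\<bar>} \<le> e * \<bar>c\<bar> powr p"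
    "\<bar>expectation (\<lambda>\<omega>. t (c * X \<omega>))\<bar> \<le> e * \<bar>c\<bar> powr p"
    "expectation (\<lambda>\<omega>. (t (c * X \<omega>))\<^sup>2) \<le> e * \<bar>c\<bar> powr p" by auto
qed

text \<open>
  Either some summand exceeds 1 in modulus, or the sum coincides with the sum of its truncated
  summands; the first event is handled by a union bound, the second by the second-moment method.
\<close>

lemma weighted_sum_weak_bound:
  fixes X :: "'i \<Rightarrow> 'a \<Rightarrow> real"
  assumes fin: "finite I" and ind: "indep_vars (\<lambda>_. borel) X I"
    and D: "\<And>i. i \<in> I \<Longrightarrow> distr M borel (X i) = D"
    and int: "integrable D (\<lambda>y. y)" and mean: "(\<integral>y. y \<partial>D) = 0"
    and bd: "weak_moment_bounds D p r e"
    and c: "\<And>i. i \<in> I \<Longrightarrow> \<bar>c i\<bar> * r \<le> 1"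
    and A: "(\<Sum>i\<in>I. \<bar>c i\<bar> powr p) \<le> A"
    and \<delta>: "0 < \<delta>"
  shows "prob {\<omega> \<in> space M. \<delta> < \<bar>\<Sum>i\<in>I. c i * X i \<omega>\<bar>} \<le> e * A + (e * A + (e * A)\<^sup>2) / \<delta>\<^sup>2"
proof -
  have e: "0 \<le> e" using bd by (rule weak_moment_bounds_nonneg)
  define t :: "real \<Rightarrow> real" where "t = (\<lambda>y. y * indicator {y. \<bar>y\<bar> \<le> 1} y)"
  define Y where "Y i \<omega> = t (c i * X i \<omega>)" for i \<omega>
  have X[measurable]: "i \<in> I \<Longrightarrow> random_variable borel (X i)" for i
    using ind by (auto simp: indep_vars_def)
  have t[measurable]: "t \<in> borel_measurable borel" unfolding t_def by measurable
  have Y[measurable]: "i \<in> I \<Longrightarrow> random_variable borel (Y i)" for i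
    unfolding Y_def by measurable
  have indY: "indep_vars (\<lambda>_. borel) Y I"
    unfolding Y_def using ind by (rule indep_vars_compose2) measurable
  have Ysq: "integrable M (\<lambda>\<omega>. (Y i \<omega>)\<^sup>2)" if "i \<in> I" for i
    using that
    by (intro integrable_const_bound[where B = 1])
       (auto simp: Y_def t_def indicator_def abs_square_le_1)
  note bounds = truncated_multiple_bounds[OF X D int mean bd c t_def]
  define S where "S \<omega> = (\<Sum>i\<in>I. Y i \<omega>)" for \<omega>
  have S[measurable]: "random_variable borel S" unfolding S_def by measurable
  have eA: "(\<Sum>i\<in>I. e * \<bar>c i\<bar> powr p) \<le> e * A"
    using A e by (simp add: sum_distrib_left[symmetric] mult_left_mono)
  have S2: "expectation (\<lambda>\<omega>. (S \<omega>)\<^sup>2) \<le> e * A + (e * A)\<^sup>2"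
  proof -
    have "(\<Sum>i\<in>I. expectation (\<lambda>\<omega>. (Y i \<omega>)\<^sup>2)) \<le> (\<Sum>i\<in>I. e * \<bar>c i\<bar> powr p)"
      unfolding Y_def by (intro sum_mono bounds)
    moreover have "(\<Sum>i\<in>I. \<bar>expectation (Y i)\<bar>)\<^sup>2 \<le> (\<Sum>i\<in>I. e * \<bar>c i\<bar> powr p)\<^sup>2"
      unfolding Y_def by (intro power_mono sum_mono bounds sum_nonneg) auto
    moreover have "(\<Sum>i\<in>I. e * \<bar>c i\<bar> powr p)\<^sup>2 \<le> (e * A)\<^sup>2"
      using eA e by (intro power_mono sum_nonneg) auto
    ultimately show ?thesis
      using indep_second_moment_sum_le(2)[OF fin indY Ysq] eA unfolding S_def by linarith
  qed
  have ev: "\<And>i. i \<in> I \<Longrightarrow> {\<omega> \<in> space M. 1 < \<bar>c i * X i \<omega>\<bar>} \<in> events"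
    "{\<omega> \<in> space M. \<delta> \<le> \<bar>S \<omega>\<bar>} \<in> events"
    by measurable
  have "{\<omega> \<in> space M. \<delta> < \<bar>\<Sum>i\<in>I. c i * X i \<omega>\<bar>}
      \<subseteq> (\<Union>i\<in>I. {\<omega> \<in> space M. 1 < \<bar>c i * X i \<omega>\<bar>}) \<union> {\<omega> \<in> space M. \<delta> \<le> \<bar>S \<omega>\<bar>}"
  proof (intro subsetI, rule ccontr)
    fix \<omega> assume \<omega>: "\<omega> \<in> {\<omega> \<in> space M. \<delta> < \<bar>\<Sum>i\<in>I. c i * X i \<omega>\<bar>}"
      and "\<omega> \<notin> (\<Union>i\<in>I. {\<omega> \<in> space M. 1 < \<bar>c i * X i \<omega>\<bar>}) \<union> {\<omega> \<in> space M. \<delta> \<le> \<bar>S \<omega>\<bar>}"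
    then have small: "\<And>i. i \<in> I \<Longrightarrow> \<bar>c i * X i \<omega>\<bar> \<le> 1" and "\<bar>S \<omega>\<bar> < \<delta>"
      by (auto simp: not_le not_less)
    have "S \<omega> = (\<Sum>i\<in>I. c i * X i \<omega>)"
      unfolding S_def Y_def t_def using small by (intro sum.cong) auto
    with \<omega> \<open>\<bar>S \<omega>\<bar> < \<delta>\<close> show False by simp
  qed
  then have "prob {\<omega> \<in> space M. \<delta> < \<bar>\<Sum>i\<in>I. c i * X i \<omega>\<bar>}
      \<le> prob ((\<Union>i\<in>I. {\<omega> \<in> space M. 1 < \<bar>c i * X i \<omega>\<bar>}) \<union> {\<omega> \<in> space M. \<delta> \<le> \<bar>S \<omega>\<bar>})"
    by (intro finite_measure_mono sets.Un sets.finite_UN fin ev)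
  also have "\<dots> \<le> prob (\<Union>i\<in>I. {\<omega> \<in> space M. 1 < \<bar>c i * X i \<omega>\<bar>}) + prob {\<omega> \<in> space M. \<delta> \<le> \<bar>S \<omega>\<bar>}"
    by (intro measure_Un_le sets.finite_UN fin ev)
  also have "prob (\<Union>i\<in>I. {\<omega> \<in> space M. 1 < \<bar>c i * X i \<omega>\<bar>})
      \<le> (\<Sum>i\<in>I. prob {\<omega> \<in> space M. 1 < \<bar>c i * X i \<omega>\<bar>})"
    by (intro finite_measure_subadditive_finite fin) (use ev in blast)
  also have "\<dots> \<le> (\<Sum>i\<in>I. e * \<bar>c i\<bar> powr p)"
    by (intro sum_mono bounds)
  also note eA
  also have "prob {\<omega> \<in> space M. \<delta> \<le> \<bar>S \<omega>\<bar>} \<le> expectation (\<lambda>\<omega>. (S \<omega>)\<^sup>2) / \<delta>\<^sup>2"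
    using \<delta> indep_second_moment_sum_le(1)[OF fin indY Ysq]
    by (intro second_moment_method) (auto simp: S_def)
  also have "\<dots> \<le> (e * A + (e * A)\<^sup>2) / \<delta>\<^sup>2"
    using S2 by (intro divide_right_mono) auto
  finally show ?thesis by simp
qed

end

section \<open>Almost sure convergence of independent series\<close>

context prob_space
begin

text \<open>
  Split according to the first time \<open>m\<close> at which the partial sum leaves \<open>[- 2 * a, 2 * a]\<close>.
  This event is independent of the increment from \<open>m\<close> to \<open>n\<close>, which is at most \<open>a\<close> in modulus with
  probability at least one half, and in that case the final sum still exceeds \<open>a\<close> in modulus. As only
  tail probabilities occur, the inequality applies to summands of infinite variance.
\<close>

lemma ottaviani_inequality:
  fixes X :: "nat \<Rightarrow> 'a \<Rightarrow> real"
  assumes ind: "indep_vars (\<lambda>_. borel) X UNIV"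
    and half: "\<And>m. m \<in> {N..n} \<Longrightarrow> prob {\<omega> \<in> space M. a < \<bar>\<Sum>i\<in>{m..<n}. X i \<omega>\<bar>} \<le> 1 / 2"
  shows "prob {\<omega> \<in> space M. \<exists>m\<in>{N..n}. 2 * a < \<bar>\<Sum>i\<in>{N..<m}. X i \<omega>\<bar>}
    \<le> 2 * prob {\<omega> \<in> space M. a < \<bar>\<Sum>i\<in>{N..<n}. X i \<omega>\<bar>}"
proof -
  have X[measurable]: "random_variable borel (X i)" for i
    using ind by (auto simp: indep_vars_def)
  define F where "F m = {\<omega> \<in> space M. 2 * a < \<bar>\<Sum>i\<in>{N..<m}. X i \<omega>\<bar> \<and>
      (\<forall>l\<in>{N..<m}. \<bar>\<Sum>i\<in>{N..<l}. X i \<omega>\<bar> \<le> 2 * a)}" for m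
  define G where "G m = {\<omega> \<in> space M. \<bar>\<Sum>i\<in>{m..<n}. X i \<omega>\<bar> \<le> a}" for m
  have F[measurable]: "F m \<in> events" and G[measurable]: "G m \<in> events" for m
    unfolding F_def G_def by measurable
  have indep: "prob (F m \<inter> G m) = prob (F m) * prob (G m)" for m
  proof -
    let ?P = "\<lambda>J. PiM J (\<lambda>_. borel :: real measure)" and ?R = "\<lambda>J \<omega>. restrict (\<lambda>i. X i \<omega>) J"
    have meas: "(\<lambda>f. \<Sum>i\<in>K. f i) \<in> borel_measurable (?P J)" if "K \<subseteq> J" for K J :: "nat set"
      using that by (intro borel_measurable_sum measurable_component_singleton) auto
    define U where "U = {f \<in> space (?P {N..<m}). 2 * a < \<bar>\<Sum>i\<in>{N..<m}. f i\<bar> \<and>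
      (\<forall>l\<in>{N..<m}. \<bar>\<Sum>i\<in>{N..<l}. f i\<bar> \<le> 2 * a)}"
    define V where "V = {f \<in> space (?P {m..<n}). \<bar>\<Sum>i\<in>{m..<n}. f i\<bar> \<le> a}"
    have U: "U \<in> sets (?P {N..<m})"
      unfolding U_def
      by (intro sets.sets_Collect borel_measurable_less borel_measurable_le borel_measurable_abs
           measurable_const meas) auto
    have V: "V \<in> sets (?P {m..<n})"
      unfolding V_def
      by (intro borel_measurable_le borel_measurable_abs measurable_const meas) auto
    have FU: "F m = ?R {N..<m} -` U \<inter> space M"
    proof -
      have "(\<Sum>i\<in>{N..<l}. ?R {N..<m} \<omega> i) = (\<Sum>i\<in>{N..<l}. X i \<omega>)" if "l \<le> m" for l \<omega>
        using that by (intro sum.cong) auto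
      then show ?thesis by (auto simp: F_def U_def space_PiM)
    qed
    have GV: "G m = ?R {m..<n} -` V \<inter> space M"
      by (auto simp: G_def V_def space_PiM)
    have "prob ((\<lambda>\<omega>. (?R {N..<m} \<omega>, ?R {m..<n} \<omega>)) -` (U \<times> V) \<inter> space M)
        = prob (F m) * prob (G m)"
      unfolding FU GV by (intro indep_varD[OF indep_var_restrict[OF ind] U V]) auto
    moreover have "(\<lambda>\<omega>. (?R {N..<m} \<omega>, ?R {m..<n} \<omega>)) -` (U \<times> V) \<inter> space M = F m \<inter> G m"
      unfolding FU GV by auto
    ultimately show ?thesis by simp
  qed
  have disj: "disjoint_family_on F {N..n}"
  proof (unfold disjoint_family_on_def, intro ballI impI equals0I)
    fix m m' \<omega> assume m: "m \<in> {N..n}" "m' \<in> {N..n}" "m \<noteq> m'" and \<omega>: "\<omega> \<in> F m \<inter> F m'"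
    have "\<not> k < l" if "\<omega> \<in> F k" "\<omega> \<in> F l" "N \<le> k" for k l
      using that by (auto simp: F_def not_less[symmetric])
    from this[of m m'] this[of m' m] m \<omega> show False by auto
  qed
  have cover: "{\<omega> \<in> space M. \<exists>m\<in>{N..n}. 2 * a < \<bar>\<Sum>i\<in>{N..<m}. X i \<omega>\<bar>} = (\<Union>m\<in>{N..n}. F m)"
  proof (intro equalityI subsetI)
    fix \<omega> assume "\<omega> \<in> {\<omega> \<in> space M. \<exists>m\<in>{N..n}. 2 * a < \<bar>\<Sum>i\<in>{N..<m}. X i \<omega>\<bar>}"
    then obtain m where m: "\<omega> \<in> space M" "m \<in> {N..n}" "2 * a < \<bar>\<Sum>i\<in>{N..<m}. X i \<omega>\<bar>" by auto
    let ?P = "\<lambda>m. m \<in> {N..n} \<and> 2 * a < \<bar>\<Sum>i\<in>{N..<m}. X i \<omega>\<bar>"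
    define k where "k = (LEAST m. ?P m)"
    have k: "?P k" unfolding k_def by (rule LeastI[of ?P m]) (use m in auto)
    have "\<not> ?P l" if "l < k" for l using that unfolding k_def by (rule not_less_Least)
    then have "\<bar>\<Sum>i\<in>{N..<l}. X i \<omega>\<bar> \<le> 2 * a" if "l \<in> {N..<k}" for l
      using that k by (meson atLeastAtMost_iff atLeastLessThan_iff less_imp_le not_less order_trans)
    then have "\<omega> \<in> F k" using k m(1) by (simp add: F_def)
    then show "\<omega> \<in> (\<Union>m\<in>{N..n}. F m)" using k by auto
  qed (auto simp: F_def)
  have Ghalf: "1 / 2 \<le> prob (G m)" if "m \<in> {N..n}" for m
  proof -
    have "prob (space M - {\<omega> \<in> space M. a < \<bar>\<Sum>i\<in>{m..<n}. X i \<omega>\<bar>})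
        = 1 - prob {\<omega> \<in> space M. a < \<bar>\<Sum>i\<in>{m..<n}. X i \<omega>\<bar>}"
      by (intro prob_compl) measurable
    moreover have "space M - {\<omega> \<in> space M. a < \<bar>\<Sum>i\<in>{m..<n}. X i \<omega>\<bar>} = G m"
      by (auto simp: G_def)
    ultimately show ?thesis using half[OF that] by simp
  qed
  have "prob (\<Union>m\<in>{N..n}. F m) = (\<Sum>m\<in>{N..n}. prob (F m))"
    using disj by (intro finite_measure_finite_Union) auto
  also have "\<dots> \<le> (\<Sum>m\<in>{N..n}. 2 * prob (F m \<inter> G m))"
  proof (intro sum_mono)
    fix m assume "m \<in> {N..n}"
    then have "prob (F m) * (1 / 2) \<le> prob (F m) * prob (G m)"
      by (intro mult_left_mono Ghalf) auto
    then show "prob (F m) \<le> 2 * prob (F m \<inter> G m)" unfolding indep by simp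
  qed
  also have "\<dots> = 2 * prob (\<Union>m\<in>{N..n}. F m \<inter> G m)"
    using disj unfolding sum_distrib_left[symmetric]
    by (subst finite_measure_finite_Union) (auto simp: disjoint_family_on_def)
  also have "prob (\<Union>m\<in>{N..n}. F m \<inter> G m) \<le> prob {\<omega> \<in> space M. a < \<bar>\<Sum>i\<in>{N..<n}. X i \<omega>\<bar>}"
  proof (intro finite_measure_mono subsetI)
    fix \<omega> assume "\<omega> \<in> (\<Union>m\<in>{N..n}. F m \<inter> G m)"
    then obtain m where m: "m \<in> {N..n}" "\<omega> \<in> F m" "\<omega> \<in> G m" by auto
    have "(\<Sum>i\<in>{N..<n}. X i \<omega>) = (\<Sum>i\<in>{N..<m}. X i \<omega>) + (\<Sum>i\<in>{m..<n}. X i \<omega>)"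
      using m(1) by (simp add: sum.atLeastLessThan_concat)
    with m show "\<omega> \<in> {\<omega> \<in> space M. a < \<bar>\<Sum>i\<in>{N..<n}. X i \<omega>\<bar>}"
      by (auto simp: F_def G_def)
  qed measurable
  finally show ?thesis unfolding cover by simp
qed

text \<open>
  Ottaviani's inequality bounds the oscillation of the partial sums on a window from \<open>N\<close> to \<open>n\<close>
  uniformly in \<open>n\<close>. Letting \<open>n\<close> and then \<open>N\<close> grow, the oscillation after \<open>N\<close> tends to 0 almost surely.
\<close>

lemma AE_summable_if_Cauchy_in_probability:
  fixes X :: "nat \<Rightarrow> 'a \<Rightarrow> real"
  assumes ind: "indep_vars (\<lambda>_. borel) X UNIV"
    and Cauchy: "\<And>a \<eta>. a > 0 \<Longrightarrow> \<eta> > 0 \<Longrightarrow>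
      \<exists>N. \<forall>m\<ge>N. \<forall>n\<ge>m. prob {\<omega> \<in> space M. a < \<bar>\<Sum>i\<in>{m..<n}. X i \<omega>\<bar>} \<le> \<eta>"
  shows "AE \<omega> in M. summable (\<lambda>i. X i \<omega>)"
proof -
  have X[measurable]: "random_variable borel (X i)" for i
    using ind by (auto simp: indep_vars_def)
  have osc: "AE \<omega> in M. \<exists>N. \<forall>m\<ge>N. \<bar>\<Sum>i\<in>{N..<m}. X i \<omega>\<bar> \<le> 2 * a" if a: "a > 0" for a
  proof -
    define B where "B N = {\<omega> \<in> space M. \<exists>m\<ge>N. 2 * a < \<bar>\<Sum>i\<in>{N..<m}. X i \<omega>\<bar>}" for N
    have B[measurable]: "B N \<in> events" for N unfolding B_def by measurable
    have "prob (\<Inter>N. B N) \<le> 0 + \<eta>" if "\<eta> > 0" for \<eta>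
    proof -
      obtain N where N: "\<And>m n. m \<ge> N \<Longrightarrow> n \<ge> m \<Longrightarrow>
          prob {\<omega> \<in> space M. a < \<bar>\<Sum>i\<in>{m..<n}. X i \<omega>\<bar>} \<le> min (1 / 2) (\<eta> / 2)"
        using Cauchy[OF a, of "min (1 / 2) (\<eta> / 2)"] \<open>\<eta> > 0\<close> by auto
      define C where "C n = {\<omega> \<in> space M. \<exists>m\<in>{N..n}. 2 * a < \<bar>\<Sum>i\<in>{N..<m}. X i \<omega>\<bar>}" for n
      have "prob (C n) \<le> \<eta>" for n
      proof (cases "N \<le> n")
        case True
        have "prob (C n) \<le> 2 * prob {\<omega> \<in> space M. a < \<bar>\<Sum>i\<in>{N..<n}. X i \<omega>\<bar>}"
          unfolding C_def using N by (intro ottaviani_inequality ind) auto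
        with N[of N n] True show ?thesis by simp
      next
        case False
        then show ?thesis using \<open>\<eta> > 0\<close> by (simp add: C_def)
      qed
      moreover have "(\<lambda>n. prob (C n)) \<longlonglongrightarrow> prob (\<Union>n. C n)"
      proof (rule finite_Lim_measure_incseq)
        show "range C \<subseteq> events" unfolding C_def by auto
        show "incseq C" unfolding C_def incseq_def by auto
      qed
      ultimately have "prob (\<Union>n. C n) \<le> \<eta>" by (intro LIMSEQ_le_const2) auto
      moreover have "prob (\<Inter>N. B N) \<le> prob (\<Union>n. C n)"
      proof (rule finite_measure_mono)
        have "\<omega> \<in> (\<Union>n. C n)" if "\<omega> \<in> B N" for \<omega>
        proof -
          from that obtain m where "\<omega> \<in> space M" "N \<le> m" "2 * a < \<bar>\<Sum>i\<in>{N..<m}. X i \<omega>\<bar>"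
            by (auto simp: B_def)
          then have "\<omega> \<in> C m" by (auto simp: C_def)
          then show ?thesis by blast
        qed
        then show "(\<Inter>N. B N) \<subseteq> (\<Union>n. C n)" by blast
        show "(\<Union>n. C n) \<in> events" unfolding C_def by measurable
      qed
      ultimately show ?thesis by simp
    qed
    then have "prob (\<Inter>N. B N) \<le> 0" by (rule field_le_epsilon)
    then have "prob (\<Inter>N. B N) = 0" by (simp add: measure_le_0_iff)
    then have "(\<Inter>N. B N) \<in> null_sets M"
      by (intro null_setsI) (auto simp: emeasure_eq_measure)
    then show ?thesis
      by (rule AE_I') (auto simp: B_def not_le)
  qed
  have "AE \<omega> in M. \<forall>k::nat. \<exists>N. \<forall>m\<ge>N. \<bar>\<Sum>i\<in>{N..<m}. X i \<omega>\<bar> \<le> 2 * (1 / real (Suc k))"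
    unfolding AE_all_countable by (intro allI osc) simp
  then show ?thesis
  proof (rule AE_mp, intro AE_I2 impI)
    fix \<omega> assume *: "\<forall>k::nat. \<exists>N. \<forall>m\<ge>N. \<bar>\<Sum>i\<in>{N..<m}. X i \<omega>\<bar> \<le> 2 * (1 / real (Suc k))"
    show "summable (\<lambda>i. X i \<omega>)"
      unfolding summable_Cauchy
    proof (intro allI impI)
      fix e :: real assume "e > 0"
      then obtain k where k: "1 / real (Suc k) < e / 4"
        using nat_approx_posE[of "e / 4"] by auto
      obtain N where N: "\<And>m. m \<ge> N \<Longrightarrow> \<bar>\<Sum>i\<in>{N..<m}. X i \<omega>\<bar> \<le> 2 * (1 / real (Suc k))"
        using * by blast
      have "norm (\<Sum>i\<in>{m..<n}. X i \<omega>) < e" if "m \<ge> N" for m n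
      proof (cases "m \<le> n")
        case True
        have "(\<Sum>i\<in>{N..<n}. X i \<omega>) = (\<Sum>i\<in>{N..<m}. X i \<omega>) + (\<Sum>i\<in>{m..<n}. X i \<omega>)"
          using that True by (simp add: sum.atLeastLessThan_concat)
        then show ?thesis using N[of m] N[of n] k that True by auto
      qed (use \<open>e > 0\<close> in auto)
      then show "\<exists>N. \<forall>m\<ge>N. \<forall>n. norm (\<Sum>i\<in>{m..<n}. X i \<omega>) < e" by blast
    qed
  qed
qed

end

section \<open>The weights\<close>

lemma weight_step: "weight \<psi> n (j - 1) = weight \<psi> n j + \<psi> (int n - j + 1) - \<psi> (1 - j)"
proof (induction n)
  case (Suc n)
  then show ?case by (simp add: weight_def algebra_simps)
qed (simp add: weight_def)

lemma weight_slow_variation: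
  assumes B: "\<And>i. \<bar>\<psi> i\<bar> \<le> B"
  shows "\<bar>weight \<psi> n j\<bar> - 2 * B * real m \<le> \<bar>weight \<psi> n (j - int m)\<bar>"
proof (induction m)
  case (Suc m)
  have "weight \<psi> n (j - int (Suc m)) = weight \<psi> n (j - int m)
      + \<psi> (int n - (j - int m) + 1) - \<psi> (1 - (j - int m))"
    using weight_step[of \<psi> n "j - int m"] by (simp add: algebra_simps)
  then have "\<bar>weight \<psi> n (j - int m)\<bar> - 2 * B \<le> \<bar>weight \<psi> n (j - int (Suc m))\<bar>"
    using B[of "int n - (j - int m) + 1"] B[of "1 - (j - int m)"] by linarith
  with Suc.IH show ?case by (simp add: algebra_simps)
qed simp

lemma weight_norm_powr:
  assumes "0 < p"
  shows "weight_norm \<psi> p n powr p = (\<Sum>\<^sub>\<infinity>j\<in>{..int n}. \<bar>weight \<psi> n j\<bar> powr p)"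
  using assms by (simp add: weight_norm_def powr_powr infsum_nonneg)

text \<open>
  Positivity of the norm already implies that the family is summable, since otherwise its
  \<open>infsum\<close> would be 0.
\<close>

lemma sum_weight_powr_le:
  assumes "0 < weight_norm \<psi> p n" "0 < p" "finite J" "J \<subseteq> {..int n}"
  shows "(\<Sum>j\<in>J. \<bar>weight \<psi> n j\<bar> powr p) \<le> weight_norm \<psi> p n powr p"
proof -
  have "(\<lambda>j. \<bar>weight \<psi> n j\<bar> powr p) summable_on {..int n}"
  proof (rule ccontr)
    assume "\<not> (\<lambda>j. \<bar>weight \<psi> n j\<bar> powr p) summable_on {..int n}"
    then have "weight_norm \<psi> p n = 0"
      by (simp add: weight_norm_def infsum_not_exists)
    with assms(1) show False by simp
  qed
  then show ?thesis
    unfolding weight_norm_powr[OF assms(2)] using assms by (intro finite_sum_le_infsum) auto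
qed

text \<open>
  By \<open>weight_slow_variation\<close> a weight of size \<open>a\<close> is followed, to its left, by at least
  \<open>a / (4 * B)\<close> weights (itself included) of size at least \<open>a / 2\<close>; all of them count in the norm.
  Going left keeps the indices in the range of the norm.
\<close>

lemma single_weight_le:
  assumes B: "\<And>i. \<bar>\<psi> i\<bar> \<le> B" "0 < B" and p: "0 < p"
    and W: "0 < weight_norm \<psi> p n" and j: "j \<le> int n"
  shows "\<bar>weight \<psi> n j\<bar> powr p * \<bar>weight \<psi> n j\<bar> \<le> 4 * B * 2 powr p * weight_norm \<psi> p n powr p"
proof -
  define a where "a = \<bar>weight \<psi> n j\<bar>"
  have a: "0 \<le> a" by (simp add: a_def)
  define L where "L = nat \<lfloor>a / (4 * B)\<rfloor>"
  define J where "J = (\<lambda>m. j - int m) ` {..L}"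
  have L: "real L \<le> a / (4 * B)" "a / (4 * B) \<le> real (Suc L)"
    using a B(2) by (auto simp: L_def of_nat_nat floor_le_iff) linarith
  have "(a / 2) powr p * (a / (4 * B)) \<le> (a / 2) powr p * real (Suc L)"
    using L by (intro mult_left_mono) auto
  also have "\<dots> = (\<Sum>m\<in>{..L}. (a / 2) powr p)" by simp
  also have "\<dots> \<le> (\<Sum>m\<in>{..L}. \<bar>weight \<psi> n (j - int m)\<bar> powr p)"
  proof (intro sum_mono powr_mono2)
    fix m assume "m \<in> {..L}"
    then have "real m \<le> a / (4 * B)" using L(1) by simp
    then have "2 * B * real m \<le> a / 2" using B(2) by (simp add: field_simps)
    then show "a / 2 \<le> \<bar>weight \<psi> n (j - int m)\<bar>"
      using weight_slow_variation[of \<psi> B n j m, OF B(1)] by (simp add: a_def)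
  qed (use a p in auto)
  also have "\<dots> = (\<Sum>i\<in>J. \<bar>weight \<psi> n i\<bar> powr p)"
    unfolding J_def by (subst sum.reindex) (auto simp: inj_on_def)
  also have "\<dots> \<le> weight_norm \<psi> p n powr p"
    using j by (intro sum_weight_powr_le W p) (auto simp: J_def)
  finally have "(a / 2) powr p * (a / (4 * B)) \<le> weight_norm \<psi> p n powr p" .
  then have "a powr p * a \<le> 4 * B * 2 powr p * weight_norm \<psi> p n powr p"
    using a B(2) by (simp add: powr_divide field_simps)
  then show ?thesis by (simp add: a_def)
qed

text \<open>
  The previous lemma bounds the largest weight by a constant times \<open>W powr (p / (p + 1))\<close> for the
  norm \<open>W\<close>, which is below \<open>W / r\<close> as soon as \<open>W\<close> is large; the threshold is what solving this
  inequality for \<open>W\<close> gives.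
\<close>

lemma weight_negligible:
  assumes B: "\<And>i. \<bar>\<psi> i\<bar> \<le> B" "0 < B" and p: "0 < p" and r: "0 < r"
    and W: "4 * B * (2 * r) powr p * r < weight_norm \<psi> p n" and j: "j \<le> int n"
  shows "\<bar>weight \<psi> n j\<bar> * r \<le> weight_norm \<psi> p n"
proof (rule ccontr)
  define W where "W = weight_norm \<psi> p n"
  have "0 < 4 * B * (2 * r) powr p * r" using B r by simp
  with W have W0: "0 < W" unfolding W_def by linarith
  assume "\<not> ?thesis"
  then have "W / r \<le> \<bar>weight \<psi> n j\<bar>" using r by (simp add: W_def field_simps)
  then have "(W / r) powr p * (W / r) \<le> \<bar>weight \<psi> n j\<bar> powr p * \<bar>weight \<psi> n j\<bar>"
    using W0 r p by (intro mult_mono powr_mono2) auto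
  also have "\<dots> \<le> 4 * B * 2 powr p * W powr p"
    using single_weight_le[OF B p _ j] W0 by (simp add: W_def)
  finally have "W powr p * W \<le> W powr p * (4 * B * 2 powr p * r powr p * r)"
    using r W0 by (simp add: powr_divide field_simps)
  then have "W \<le> 4 * B * (2 * r) powr p * r"
    using W0 r by (simp add: powr_mult)
  with W show False by (simp add: W_def)
qed

definition cutoff :: "nat \<Rightarrow> (int \<Rightarrow> real) \<Rightarrow> int \<Rightarrow> real" where
  "cutoff N \<psi> i = (if i < int N then \<psi> i else 0)"

text \<open>
  The interval \<open>{- int N..int n}\<close> contains every index of noise that occurs on the left; the
  extra ones have coefficient 0.
\<close>

lemma truncated_partial_sum_eq:
  assumes neg: "\<And>j. j < 0 \<Longrightarrow> \<psi> j = 0"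
  shows "(\<Sum>k=1..n. \<Sum>i<N. \<psi> (int i) * x (int k - int i))
    = (\<Sum>j\<in>{- int N..int n}. weight (cutoff N \<psi>) n j * x j)"
proof -
  have "(\<Sum>j\<in>{- int N..int n}. cutoff N \<psi> (int k - j) * x j) = (\<Sum>i<N. \<psi> (int i) * x (int k - int i))"
    if k: "k \<in> {1..n}" for k
  proof -
    have "(\<Sum>j\<in>{- int N..int n}. cutoff N \<psi> (int k - j) * x j)
        = (\<Sum>j\<in>(\<lambda>i. int k - int i) ` {..<N}. cutoff N \<psi> (int k - j) * x j)"
    proof (rule sum.mono_neutral_right)
      show "\<forall>j\<in>{- int N..int n} - (\<lambda>i. int k - int i) ` {..<N}. cutoff N \<psi> (int k - j) * x j = 0"
      proof
        fix j assume j: "j \<in> {- int N..int n} - (\<lambda>i. int k - int i) ` {..<N}"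
        have "\<not> (0 \<le> int k - j \<and> int k - j < int N)"
        proof
          assume "0 \<le> int k - j \<and> int k - j < int N"
          then have "j = int k - int (nat (int k - j))" "nat (int k - j) \<in> {..<N}" by auto
          with j show False by blast
        qed
        then show "cutoff N \<psi> (int k - j) * x j = 0"
          using neg[of "int k - j"] by (auto simp: cutoff_def)
      qed
    qed (use k in auto)
    also have "\<dots> = (\<Sum>i<N. \<psi> (int i) * x (int k - int i))"
      by (subst sum.reindex) (auto simp: inj_on_def cutoff_def intro!: sum.cong)
    finally show ?thesis .
  qed
  then have "(\<Sum>k=1..n. \<Sum>i<N. \<psi> (int i) * x (int k - int i))
      = (\<Sum>k=1..n. \<Sum>j\<in>{- int N..int n}. cutoff N \<psi> (int k - j) * x j)"
    by (intro sum.cong) auto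
  also have "\<dots> = (\<Sum>j\<in>{- int N..int n}. weight (cutoff N \<psi>) n j * x j)"
    unfolding weight_def sum_distrib_right by (rule sum.swap)
  finally show ?thesis .
qed

text \<open>
  For \<open>j > n - N\<close> the cutoff does not change the weight. The remaining indices
  \<open>- N \<le> j \<le> n - N\<close> number \<open>n + 1\<close> whatever \<open>N\<close> is, and there only values \<open>\<psi> i\<close> with
  \<open>i > N - n\<close> enter, which tend to 0. So the \<open>p\<close>-th power sum of the cut-off weights exceeds that of
  the original ones by an amount tending to 0; the bound 2 leaves room for it.
\<close>

lemma normalized_truncated_weights:
  assumes null: "(\<lambda>i. \<psi> (int i)) \<longlonglongrightarrow> 0" and p: "0 < p" and r: "0 < r"
    and W: "0 < weight_norm \<psi> p n"
    and neglig: "\<And>j. j \<le> int n \<Longrightarrow> \<bar>weight \<psi> n j\<bar> * r \<le> weight_norm \<psi> p n"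
  obtains N0 where
    "\<And>N j. N0 \<le> N \<Longrightarrow> j \<le> int n \<Longrightarrow> - int N \<le> j \<Longrightarrow>
       \<bar>weight (cutoff N \<psi>) n j / weight_norm \<psi> p n\<bar> * r \<le> 1"
    "\<And>N. N0 \<le> N \<Longrightarrow>
       (\<Sum>j\<in>{- int N..int n}. \<bar>weight (cutoff N \<psi>) n j / weight_norm \<psi> p n\<bar> powr p) \<le> 2"
proof -
  define W where "W = weight_norm \<psi> p n"
  have W0: "0 < W" using W by (simp add: W_def)
  (* The size of the boundary weights that both conclusions tolerate. *)
  define \<kappa> where "\<kappa> = min (W / r) (W / real (Suc n) powr (1 / p))"
  have \<kappa>: "0 < \<kappa>" "\<kappa> * r \<le> W" "real (Suc n) * \<kappa> powr p \<le> W powr p"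
  proof -
    show "0 < \<kappa>" using W0 r by (simp add: \<kappa>_def)
    have "\<kappa> \<le> W / r" by (simp add: \<kappa>_def)
    then show "\<kappa> * r \<le> W" using r by (simp add: field_simps)
    have "\<kappa> powr p \<le> (W / real (Suc n) powr (1 / p)) powr p"
      using \<open>0 < \<kappa>\<close> p by (intro powr_mono2) (auto simp: \<kappa>_def)
    also have "\<dots> = W powr p / real (Suc n)"
      using W0 p by (simp add: powr_divide powr_powr)
    finally show "real (Suc n) * \<kappa> powr p \<le> W powr p" by (simp add: field_simps)
  qed
  have "eventually (\<lambda>i. \<bar>\<psi> (int i)\<bar> < \<kappa> / real (Suc n)) sequentially"
    using tendsto_rabs_zero[OF null] by (rule order_tendstoD) (use \<kappa> in auto)
  then obtain N1 where N1: "\<And>i. i \<ge> N1 \<Longrightarrow> \<bar>\<psi> (int i)\<bar> < \<kappa> / real (Suc n)"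
    by (auto simp: eventually_sequentially)
  have old: "weight (cutoff N \<psi>) n j = weight \<psi> n j" if "int n - int N < j" for N j
    using that unfolding weight_def cutoff_def by (intro sum.cong) auto
  have new: "\<bar>weight (cutoff N \<psi>) n j\<bar> \<le> \<kappa>" if "N1 + n \<le> N" "j \<le> int n - int N" for N j
  proof -
    have "\<bar>weight (cutoff N \<psi>) n j\<bar> \<le> (\<Sum>k=1..n. \<bar>cutoff N \<psi> (int k - j)\<bar>)"
      unfolding weight_def by (rule sum_abs)
    also have "\<dots> \<le> (\<Sum>k=1..n. \<kappa> / real (Suc n))"
    proof (intro sum_mono)
      fix k assume k: "k \<in> {1..n}"
      have "int N1 \<le> int k - j" using that k by auto
      then have "\<bar>\<psi> (int (nat (int k - j)))\<bar> < \<kappa> / real (Suc n)" by (intro N1) linarith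
      then show "\<bar>cutoff N \<psi> (int k - j)\<bar> \<le> \<kappa> / real (Suc n)"
        using \<open>int N1 \<le> int k - j\<close> \<kappa>(1) by (auto simp: cutoff_def)
    qed
    also have "\<dots> = \<kappa> * (real n / real (Suc n))" by simp
    also have "\<dots> \<le> \<kappa>" using \<kappa>(1) by (intro mult_left_le) (auto simp: field_simps)
    finally show ?thesis .
  qed
  show ?thesis
  proof (rule that[of "N1 + n", folded W_def])
    fix N j assume N: "N1 + n \<le> N" and j: "j \<le> int n"
    have "\<bar>weight (cutoff N \<psi>) n j\<bar> * r \<le> W"
    proof (cases "int n - int N < j")
      case True
      then show ?thesis using neglig[OF j] old by (simp add: W_def)
    next
      case False
      then have "\<bar>weight (cutoff N \<psi>) n j\<bar> * r \<le> \<kappa> * r"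
        using r N by (intro mult_right_mono new) auto
      then show ?thesis using \<kappa>(2) by linarith
    qed
    then show "\<bar>weight (cutoff N \<psi>) n j / W\<bar> * r \<le> 1"
      using W0 by (simp add: abs_div field_simps)
  next
    fix N assume N: "N1 + n \<le> N"
    let ?w = "\<lambda>j. \<bar>weight (cutoff N \<psi>) n j\<bar> powr p"
    have "(\<Sum>j\<in>{- int N..int n}. ?w j)
        = (\<Sum>j\<in>{- int N..int n - int N}. ?w j) + (\<Sum>j\<in>{int n - int N<..int n}. ?w j)"
      by (subst sum.union_disjoint[symmetric]) (auto intro!: sum.cong)
    also have "(\<Sum>j\<in>{- int N..int n - int N}. ?w j) \<le> (\<Sum>j\<in>{- int N..int n - int N}. \<kappa> powr p)"
      using p N by (intro sum_mono powr_mono2 new) auto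
    also have "\<dots> = real (Suc n) * \<kappa> powr p" by simp
    also note \<kappa>(3)
    also have "(\<Sum>j\<in>{int n - int N<..int n}. ?w j)
        = (\<Sum>j\<in>{int n - int N<..int n}. \<bar>weight \<psi> n j\<bar> powr p)"
      by (intro sum.cong) (auto simp: old)
    also have "\<dots> \<le> W powr p"
      unfolding W_def using W p by (intro sum_weight_powr_le) auto
    finally have "(\<Sum>j\<in>{- int N..int n}. ?w j) \<le> 2 * W powr p" by simp
    then have "(\<Sum>j\<in>{- int N..int n}. ?w j) / W powr p \<le> 2"
      using W0 by (simp add: pos_divide_le_eq)
    moreover have "(\<Sum>j\<in>{- int N..int n}. \<bar>weight (cutoff N \<psi>) n j / W\<bar> powr p)
        = (\<Sum>j\<in>{- int N..int n}. ?w j) / W powr p"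
      using W0 by (simp add: abs_div powr_divide sum_divide_distrib)
    ultimately show "(\<Sum>j\<in>{- int N..int n}. \<bar>weight (cutoff N \<psi>) n j / W\<bar> powr p) \<le> 2"
      by (rule ord_eq_le_trans[rotated])
  qed
qed

section \<open>Convergence in probability\<close>

context prob_space
begin

text \<open>
  A Fatou argument: if the limit exceeds \<open>\<delta>\<close>, then so do all late approximations, and the events
  that all approximations from \<open>N\<close> on exceed \<open>\<delta>\<close> increase with \<open>N\<close>.
\<close>

lemma prob_limit_le:
  fixes T :: "nat \<Rightarrow> 'a \<Rightarrow> real" and S :: "'a \<Rightarrow> real"
  assumes T[measurable]: "\<And>N. random_variable borel (T N)" and S[measurable]: "random_variable borel S"
    and lim: "AE \<omega> in M. (\<lambda>N. T N \<omega>) \<longlonglongrightarrow> S \<omega>"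
    and bound: "\<And>N. L \<le> N \<Longrightarrow> prob {\<omega> \<in> space M. \<delta> < \<bar>T N \<omega>\<bar>} \<le> \<rho>"
  shows "prob {\<omega> \<in> space M. \<delta> < \<bar>S \<omega>\<bar>} \<le> \<rho>"
proof -
  define E where "E N = {\<omega> \<in> space M. \<forall>m\<ge>N. \<delta> < \<bar>T m \<omega>\<bar>}" for N
  have E: "E N \<in> events" for N unfolding E_def by measurable
  have "prob (E N) \<le> \<rho>" for N
  proof -
    have "prob (E N) \<le> prob {\<omega> \<in> space M. \<delta> < \<bar>T (max N L) \<omega>\<bar>}"
      by (intro finite_measure_mono) (auto simp: E_def)
    also have "\<dots> \<le> \<rho>" by (intro bound) simp
    finally show ?thesis .
  qed
  moreover have "(\<lambda>N. prob (E N)) \<longlonglongrightarrow> prob (\<Union>N. E N)"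
    using E by (intro finite_Lim_measure_incseq) (auto simp: incseq_def E_def)
  ultimately have "prob (\<Union>N. E N) \<le> \<rho>" by (intro LIMSEQ_le_const2) auto
  moreover have "prob {\<omega> \<in> space M. \<delta> < \<bar>S \<omega>\<bar>} \<le> prob (\<Union>N. E N)"
  proof (rule finite_measure_mono_AE)
    show "AE \<omega> in M. \<omega> \<in> {\<omega> \<in> space M. \<delta> < \<bar>S \<omega>\<bar>} \<longrightarrow> \<omega> \<in> (\<Union>N. E N)"
      using lim
    proof (rule AE_mp, intro AE_I2 impI)
      fix \<omega> assume "(\<lambda>N. T N \<omega>) \<longlonglongrightarrow> S \<omega>" and \<omega>: "\<omega> \<in> {\<omega> \<in> space M. \<delta> < \<bar>S \<omega>\<bar>}"
      then have "eventually (\<lambda>N. \<delta> < \<bar>T N \<omega>\<bar>) sequentially"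
        by (intro order_tendstoD(1)[OF tendsto_rabs]) auto
      then show "\<omega> \<in> (\<Union>N. E N)"
        using \<omega> by (auto simp: E_def eventually_sequentially)
    qed
    show "(\<Union>N. E N) \<in> events" using E by blast
  qed
  ultimately show ?thesis by simp
qed

text \<open>
  The weak-type inequality with \<open>r = 0\<close> bounds each block of the series by a function of the
  block's power sum that vanishes at 0, so the series is Cauchy in probability.
\<close>

lemma linear_process_AE_summable:
  fixes \<epsilon> :: "int \<Rightarrow> 'a \<Rightarrow> real"
  assumes ind: "indep_vars (\<lambda>_. borel) \<epsilon> UNIV"
    and D: "\<And>i. distr M borel (\<epsilon> i) = D"
    and int: "integrable D (\<lambda>y. y)" and mean: "(\<integral>y. y \<partial>D) = 0"
    and bd: "weak_moment_bounds D p 0 K"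
    and \<psi>: "summable (\<lambda>j::nat. \<bar>\<psi> (int j)\<bar> powr p)"
  shows "AE \<omega> in M. summable (\<lambda>j. \<psi> (int j) * \<epsilon> (k - int j) \<omega>)"
proof (rule AE_summable_if_Cauchy_in_probability)
  (* Reindexing an independent family: restrict it to the disjoint singletons {k - int j}. *)
  have past: "indep_vars (\<lambda>_. borel) (\<lambda>j. \<epsilon> (k - int j)) UNIV"
  proof -
    have "indep_vars (\<lambda>j. PiM {k - int j} (\<lambda>_. borel))
        (\<lambda>j \<omega>. restrict (\<lambda>i. \<epsilon> i \<omega>) {k - int j}) UNIV"
      by (rule indep_vars_restrict[OF ind]) (auto simp: disjoint_family_on_def)
    then have "indep_vars (\<lambda>_. borel)
        (\<lambda>j \<omega>. (\<lambda>f. f (k - int j)) (restrict (\<lambda>i. \<epsilon> i \<omega>) {k - int j})) UNIV"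
      by (rule indep_vars_compose2) auto
    then show ?thesis by simp
  qed
  show "indep_vars (\<lambda>_. borel) (\<lambda>j \<omega>. \<psi> (int j) * \<epsilon> (k - int j) \<omega>) UNIV"
    using past by (rule indep_vars_compose2) auto
  fix a \<eta> :: real assume a: "a > 0" and "\<eta> > 0"
  define \<phi> where "\<phi> A = K * A + (K * A + (K * A)\<^sup>2) / a\<^sup>2" for A
  have "\<phi> \<midarrow>0\<rightarrow> \<phi> 0"
    unfolding \<phi>_def using a by (intro tendsto_intros) auto
  then have "eventually (\<lambda>A. \<phi> A < \<eta>) (at 0)"
    by (rule order_tendstoD) (use \<open>\<eta> > 0\<close> in \<open>simp add: \<phi>_def\<close>)
  then obtain d where d: "d > 0" "\<And>A. A \<noteq> 0 \<Longrightarrow> \<bar>A\<bar> < d \<Longrightarrow> \<phi> A < \<eta>"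
    by (auto simp: eventually_at dist_real_def)
  obtain N where N: "\<And>m n. m \<ge> N \<Longrightarrow> \<bar>\<Sum>j\<in>{m..<n}. \<bar>\<psi> (int j)\<bar> powr p\<bar> < d / 2"
    using \<psi> half_gt_zero[OF d(1)] unfolding summable_Cauchy real_norm_def by meson
  have "prob {\<omega> \<in> space M. a < \<bar>\<Sum>j\<in>{m..<n}. \<psi> (int j) * \<epsilon> (k - int j) \<omega>\<bar>} \<le> \<eta>"
    if "m \<ge> N" for m n
  proof -
    have "prob {\<omega> \<in> space M. a < \<bar>\<Sum>j\<in>{m..<n}. \<psi> (int j) * \<epsilon> (k - int j) \<omega>\<bar>} \<le> \<phi> (d / 2)"
      unfolding \<phi>_def
    proof (rule weighted_sum_weak_bound[OF _ indep_vars_subset[OF past] D int mean bd])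
      show "(\<Sum>j\<in>{m..<n}. \<bar>\<psi> (int j)\<bar> powr p) \<le> d / 2"
        using N[OF that, of n] by simp
    qed (use a in auto)
    then show ?thesis using d(2)[of "d/2"] d(1) by simp
  qed
  then show "\<exists>N. \<forall>m\<ge>N. \<forall>n\<ge>m.
      prob {\<omega> \<in> space M. a < \<bar>\<Sum>j\<in>{m..<n}. \<psi> (int j) * \<epsilon> (k - int j) \<omega>\<bar>} \<le> \<eta>"
    by blast
qed

end

theorem theorem1:
  fixes M :: "'a measure" and \<epsilon> :: "int \<Rightarrow> 'a \<Rightarrow> real" and \<psi> :: "int \<Rightarrow> real" and p :: real
  assumes "prob_space M"
    and "1 < p" and "p < 2"
    and "prob_space.indep_vars M (\<lambda>_. borel) \<epsilon> UNIV"
    and "\<forall>k. distr M borel (\<epsilon> k) = distr M borel (\<epsilon> 0)"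
    and "((\<lambda>x::real. x powr p * \<P>(\<omega> in M. \<bar>\<epsilon> 0 \<omega>\<bar> > x)) \<longlongrightarrow> 0) at_top"
    and "integrable M (\<epsilon> 0)" and "(\<integral>\<omega>. \<epsilon> 0 \<omega> \<partial>M) = 0"
    and "\<forall>j<0. \<psi> j = 0"
    and "summable (\<lambda>j::nat. \<bar>\<psi> (int j)\<bar> powr p)"
    and "filterlim (weight_norm \<psi> p) at_top sequentially"
  shows "tendsto_in_probability M
           (\<lambda>n \<omega>. partial_sum \<psi> \<epsilon> n \<omega> / weight_norm \<psi> p n) (\<lambda>_. 0)"
proof -
  interpret prob_space M by fact
  note p = \<open>1 < p\<close> \<open>p < 2\<close>
  have p0: "0 < p" using p by simp
  note ind = assms(4)
  have \<epsilon>[measurable]: "random_variable borel (\<epsilon> i)" for i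
    using ind by (auto simp: indep_vars_def)
  define D where "D = distr M borel (\<epsilon> 0)"
  have D: "distr M borel (\<epsilon> i) = D" for i using assms(5) by (simp add: D_def)
  interpret D: real_distribution D unfolding D_def by simp
  have int: "integrable D (\<lambda>y. y)" unfolding D_def
    by (subst integrable_distr_eq) (use assms(7) in auto)
  have mean: "(\<integral>y. y \<partial>D) = 0" unfolding D_def
    by (subst integral_distr) (use assms(8) in auto)
  have "measure D {y. x < \<bar>y\<bar>} = \<P>(\<omega> in M. \<bar>\<epsilon> 0 \<omega>\<bar> > x)" for x
    unfolding D_def by (subst measure_distr) (auto simp: vimage_def Int_def conj_commute)
  with assms(6) have tail: "((\<lambda>x. x powr p * measure D {y. x < \<bar>y\<bar>}) \<longlongrightarrow> 0) at_top"
    by simp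
  have null: "(\<lambda>i. \<psi> (int i)) \<longlonglongrightarrow> 0"
  proof -
    have "(\<lambda>i. (\<bar>\<psi> (int i)\<bar> powr p) powr (1 / p)) \<longlonglongrightarrow> 0 powr (1 / p)"
      using summable_LIMSEQ_zero[OF assms(10)] p0 by (intro tendsto_powr') auto
    then have "(\<lambda>i. \<bar>\<psi> (int i)\<bar>) \<longlonglongrightarrow> 0" using p0 by (simp add: powr_powr)
    then show ?thesis by (rule tendsto_rabs_zero_cancel)
  qed
  (* The zero values at negative indices extend boundedness from the naturals to the integers. *)
  obtain B where B: "\<And>i. \<bar>\<psi> i\<bar> \<le> B" "0 < B"
  proof -
    obtain B where B: "0 < B" "\<And>i. \<bar>\<psi> (int i)\<bar> \<le> B"
      using convergent_imp_Bseq[OF convergentI[OF null]] by (auto simp: Bseq_def)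
    have "\<bar>\<psi> i\<bar> \<le> B" for i
      using B(2)[of "nat i"] B(1) assms(9) by (cases "i < 0") auto
    with B(1) show ?thesis using that by blast
  qed
  obtain K where K: "weak_moment_bounds D p 0 K"
    using D.weak_moment_bounds_uniform[OF p tail int] .
  define X where "X k i \<omega> = \<psi> (int i) * \<epsilon> (k - int i) \<omega>" for k i \<omega>
  (* The partial sums of the process whose coefficients are cut off at N. *)
  define T where "T n N \<omega> = (\<Sum>k=1..n. \<Sum>i<N. X (int k) i \<omega>)" for n N \<omega>
  have X[measurable]: "random_variable borel (X k i)" for k i unfolding X_def by measurable
  have T[measurable]: "random_variable borel (T n N)" for n N unfolding T_def by measurable
  have S: "partial_sum \<psi> \<epsilon> n \<omega> = (\<Sum>k=1..n. \<Sum>i. X (int k) i \<omega>)" for n \<omega>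
    by (simp add: partial_sum_def linear_process_def X_def)
  have S_meas[measurable]: "random_variable borel (partial_sum \<psi> \<epsilon> n)" for n
    unfolding S by measurable
  have T_lim: "AE \<omega> in M. (\<lambda>N. T n N \<omega>) \<longlonglongrightarrow> partial_sum \<psi> \<epsilon> n \<omega>" for n
  proof -
    have "AE \<omega> in M. \<forall>k. summable (\<lambda>i. X k i \<omega>)"
      unfolding AE_all_countable X_def
      using linear_process_AE_summable[OF ind D int mean K assms(10)] by blast
    then show ?thesis
      unfolding S T_def
      by (rule AE_mp) (intro AE_I2 impI tendsto_sum summable_LIMSEQ, blast)
  qed
  show ?thesis
    unfolding tendsto_in_probability_def
  proof (intro allI impI)
    fix \<delta> :: real assume \<delta>: "\<delta> > 0"
    show "(\<lambda>n. \<P>(\<omega> in M. \<bar>partial_sum \<psi> \<epsilon> n \<omega> / weight_norm \<psi> p n - 0\<bar> > \<delta>)) \<longlonglongrightarrow> 0"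
    proof (rule order_tendstoI)
      fix \<rho> :: real assume "\<rho> > 0"
      (* The bound of weighted_sum_weak_bound for power sum A = 2, as a function of the constant e. *)
      define \<phi> where "\<phi> e = e * 2 + (e * 2 + (e * 2)\<^sup>2) / \<delta>\<^sup>2" for e
      have "\<phi> \<midarrow>0\<rightarrow> \<phi> 0"
        unfolding \<phi>_def using \<delta> by (intro tendsto_intros) auto
      then have "eventually (\<lambda>e. \<phi> e < \<rho>) (at 0)"
        by (rule order_tendstoD) (use \<open>\<rho> > 0\<close> in \<open>simp add: \<phi>_def\<close>)
      then obtain d where d: "d > 0" "\<And>e. e \<noteq> 0 \<Longrightarrow> \<bar>e\<bar> < d \<Longrightarrow> \<phi> e < \<rho>"
        by (auto simp: eventually_at dist_real_def)
      define e where "e = d / 2"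
      have e: "e > 0" "\<phi> e < \<rho>" using d by (auto simp: e_def)
      obtain r where r: "0 < r" "weak_moment_bounds D p r e"
        using D.weak_moment_bounds_small[OF p tail int e(1)] .
      have "eventually (\<lambda>n. max 0 (4 * B * (2 * r) powr p * r) < weight_norm \<psi> p n) sequentially"
        using assms(11) unfolding filterlim_at_top_dense by blast
      then show "eventually (\<lambda>n. \<P>(\<omega> in M. \<bar>partial_sum \<psi> \<epsilon> n \<omega> / weight_norm \<psi> p n - 0\<bar> > \<delta>) < \<rho>) sequentially"
      proof (rule eventually_mono)
        fix n assume n: "max 0 (4 * B * (2 * r) powr p * r) < weight_norm \<psi> p n"
        define W where "W = weight_norm \<psi> p n"
        have W: "0 < W" using n by (simp add: W_def)
        have neglig: "\<bar>weight \<psi> n j\<bar> * r \<le> weight_norm \<psi> p n" if "j \<le> int n" for j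
          using n that by (intro weight_negligible[OF B p0 r(1)]) auto
        obtain N0 where N0: "\<And>N j. N0 \<le> N \<Longrightarrow> j \<le> int n \<Longrightarrow> - int N \<le> j \<Longrightarrow>
               \<bar>weight (cutoff N \<psi>) n j / W\<bar> * r \<le> 1"
            "\<And>N. N0 \<le> N \<Longrightarrow> (\<Sum>j\<in>{- int N..int n}. \<bar>weight (cutoff N \<psi>) n j / W\<bar> powr p) \<le> 2"
          using normalized_truncated_weights[OF null p0 r(1) _ neglig] W unfolding W_def by metis
        have "prob {\<omega> \<in> space M. \<delta> < \<bar>partial_sum \<psi> \<epsilon> n \<omega> / W\<bar>} \<le> \<phi> e"
        proof (rule prob_limit_le[where T = "\<lambda>N \<omega>. T n N \<omega> / W" and L = N0])
          show "AE \<omega> in M. (\<lambda>N. T n N \<omega> / W) \<longlonglongrightarrow> partial_sum \<psi> \<epsilon> n \<omega> / W"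
            using T_lim[of n] by eventually_elim (use W in \<open>intro tendsto_intros, auto\<close>)
          fix N assume N: "N0 \<le> N"
          have "T n N \<omega> / W = (\<Sum>j\<in>{- int N..int n}. (weight (cutoff N \<psi>) n j / W) * \<epsilon> j \<omega>)" for \<omega>
            using truncated_partial_sum_eq[where \<psi> = \<psi> and x = "\<lambda>j. \<epsilon> j \<omega>"] assms(9)
            by (simp add: T_def X_def sum_divide_distrib)
          then show "prob {\<omega> \<in> space M. \<delta> < \<bar>T n N \<omega> / W\<bar>} \<le> \<phi> e"
            unfolding \<phi>_def
            using N N0 \<delta>
            by (simp only:, intro weighted_sum_weak_bound[OF _ _ D int mean r(2)]
                 indep_vars_subset[OF ind]) auto
        qed measurable
        then show "\<P>(\<omega> in M. \<bar>partial_sum \<psi> \<epsilon> n \<omega> / weight_norm \<psi> p n - 0\<bar> > \<delta>) < \<rho>"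
          using e(2) by (simp add: W_def)
      qed
    qed (auto intro!: always_eventually less_le_trans[OF _ measure_nonneg])
  qed
qed

end
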